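(* Let $N\in\mathbb{N}$. Suppose that $\{\gamma(k)\}_{k\in\mathbb{N}_0}$ is i.i.d. with $\mathbf{Pr}\{\gamma(k)=1\}=q$, and that $\{\tau(k)\}_{k\in\mathbb{N}_0}$ is conditionally i.i.d. with $\mathbf{Pr}\{\tau(k)=i\mid\gamma(k)=1\}=p_i$ for $i\in\mathbb{N}_0$ and $\mathbf{Pr}\{\tau(k)=\infty\mid\gamma(k)=1\}=p_\infty$. Then the transition probabilities $p_{ij}=\mathbf{Pr}\{\lambda(k+1)=j\mid\lambda(k)=i\}$, $i,j\in\{0,1,\dots,N\}$, of the homogeneous finite Markov chain $\{\lambda(k)\}_{k\in\mathbb{N}_0}$ satisfy $$p_{ij}=\begin{cases} q\,p_{N-j} & \text{if } 1\le i\le j,\\ 1-q\sum_{\ell=0}^{N-i}p_\ell & \text{if } i=j+1,\\ 0 & \text{if } i\ge j+2,\\ p_{1j} & \text{if } i=0.\end{cases}$$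
   Context: $\mathbb{N}=\{1,2,\dots\}$, $\mathbb{N}_0=\mathbb{N}\cup\{0\}$. Setting: at each time $k\in\mathbb{N}_0$, a controller receives the plant state if $\gamma(k)=1$ (and not if $\gamma(k)=0$); when $\gamma(k)=1$ it transmits a packet of $N$ control values to a buffer at the actuator. $\tau(k)=i\in\mathbb{N}_0$ if $\gamma(k)=1$ and the packet generated at time $k$ is received at the actuator at time $k+i$; $\tau(k)=\infty$ otherwise (in particular if $\gamma(k)=0$). Hence, unconditionally, $\mathbf{Pr}\{\tau(k)=i\}=qp_i$ for $i\in\mathbb{N}_0$ and $\mathbf{Pr}\{\tau(k)=\infty\}=qp_\infty+(1-q)$, and $\{\tau(k)\}$ is i.i.d. Let $T(k)=\max\{\ell\in\mathbb{N}_0\colon\ell+\tau(\ell)\le k\}$ (with $T(k)=-\infty$ if the set is empty). The buffer length process is $\lambda(0)=0$ and $\lambda(k)=\max(0,T(k)+N-k)$ for $k\in\mathbb{N}$. It takes values in $\{0,1,\dots,N\}$.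
   Formalization: For i=0 the transition formula is asserted only if N=1, or k≥1 and k≥N−2: since λ(0)=0 is prescribed and no packet is generated before time 0, row i=0 fails in general at earlier times k (e.g. N=2, q=1/2, p_0=1, k=0). Rows i≥1 and the Markov property hold for all k. *)

theory Defs
  imports "HOL-Probability.Probability" "HOL-Library.Extended_Nat"
begin

definition delay_law :: "(nat \<Rightarrow> real) \<Rightarrow> real \<Rightarrow> enat \<Rightarrow> real" where
  "delay_law p p_inf t = (case t of enat i \<Rightarrow> p i | \<infinity> \<Rightarrow> p_inf)"

(* The delays of any finitely many packets that have been generated are independent with the
   common law. Only events of positive probability are conditioned on. For K = {k} this is
   Pr{tau(k) = i | gamma(k) = 1} = p i and Pr{tau(k) = \<infinity> | gamma(k) = 1} = p_inf. *)
definition cond_iid_delays ::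
    "'a measure \<Rightarrow> (nat \<Rightarrow> 'a \<Rightarrow> nat) \<Rightarrow> (nat \<Rightarrow> 'a \<Rightarrow> enat) \<Rightarrow> (nat \<Rightarrow> real) \<Rightarrow> real \<Rightarrow> bool" where
  "cond_iid_delays M \<gamma> \<tau> p p_inf \<longleftrightarrow>
     (\<forall>K. finite K \<longrightarrow> \<P>(\<omega> in M. \<forall>k\<in>K. \<gamma> k \<omega> = 1) > 0 \<longrightarrow>
       (\<forall>t. \<P>(\<omega> in M. (\<forall>k\<in>K. \<tau> k \<omega> = t k) \<bar> (\<forall>k\<in>K. \<gamma> k \<omega> = 1))
              = (\<Prod>k\<in>K. delay_law p p_inf (t k))))"

definition arrived :: "(nat \<Rightarrow> 'a \<Rightarrow> enat) \<Rightarrow> nat \<Rightarrow> 'a \<Rightarrow> nat set" where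
  "arrived \<tau> k \<omega> = {l. enat l + \<tau> l \<omega> \<le> enat k}"

(* The value None stands for -\<infinity>. *)
definition latest :: "(nat \<Rightarrow> 'a \<Rightarrow> enat) \<Rightarrow> nat \<Rightarrow> 'a \<Rightarrow> nat option" where
  "latest \<tau> k \<omega> = (if arrived \<tau> k \<omega> = {} then None else Some (Max (arrived \<tau> k \<omega>)))"

(* The initial value 0 is prescribed, also when the packet generated at time 0 arrives at once. *)
definition buffer_length :: "nat \<Rightarrow> (nat \<Rightarrow> 'a \<Rightarrow> enat) \<Rightarrow> nat \<Rightarrow> 'a \<Rightarrow> nat" where
  "buffer_length N \<tau> k \<omega> =
     (if k = 0 then 0
      else case latest \<tau> k \<omega> of
        None \<Rightarrow> 0
      | Some l \<Rightarrow> nat (max 0 (int l + int N - int k)))"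

(* The Markov property alone; the one-step probabilities may depend on the time k. *)
definition markov_chain :: "'a measure \<Rightarrow> nat set \<Rightarrow> (nat \<Rightarrow> 'a \<Rightarrow> nat) \<Rightarrow> bool" where
  "markov_chain M S X \<longleftrightarrow>
     (\<forall>k. X k \<in> measurable M (count_space S)) \<and>
     (\<forall>k x j. \<P>(\<omega> in M. \<forall>m\<le>k. X m \<omega> = x m) > 0 \<longrightarrow>
        \<P>(\<omega> in M. X (Suc k) \<omega> = j \<bar> (\<forall>m\<le>k. X m \<omega> = x m))
          = \<P>(\<omega> in M. X (Suc k) \<omega> = j \<bar> X k \<omega> = x k))"

(* No packet is generated before time 0. A transition out of an empty buffer at time k may be
   caused by any of the packets generated at the times k+2-N, ..., k+1, so these times have to be
   nonnegative for the probabilities not to depend on k. For k = 0 the prescribed initial value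
   may moreover hide a packet that has already arrived, unless N = 1. A nonempty buffer (i > 0) is
   never affected. *)
definition past_startup :: "nat \<Rightarrow> nat \<Rightarrow> nat \<Rightarrow> bool" where
  "past_startup N k i \<longleftrightarrow> i > 0 \<or> N = 1 \<or> (k \<ge> 1 \<and> N \<le> k + 2)"

end

theory Submission
  imports Defs
begin

text \<open>Unconditionally the delays are i.i.d. with \<open>Pr{\<tau>(k) = i} = q p\<^sub>i\<close>: the events \<open>{\<tau>(k) = i}\<close>
  with finite \<open>i\<close> generate \<open>\<sigma>(\<tau>(k))\<close> and force \<open>\<gamma>(k) = 1\<close>. Every history of \<open>\<lambda>\<close> up to time \<open>k\<close> ending
  in \<open>\<lambda>(k) = i\<close> is an event about the delays of the packets generated up to time \<open>k + i - N\<close>,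
  intersected with the event that none of the later packets has arrived by time \<open>k\<close>. Hence the
  conditional law of \<open>\<lambda>(k + 1)\<close> depends on the history through \<open>i\<close> only, and a
  nonempty buffer shrinks by one exactly when no newer packet arrives.\<close>

section \<open>Pathwise behaviour of the buffer length\<close>

lemma enat_add_le_iff: "enat l + t \<le> enat k \<longleftrightarrow> l \<le> k \<and> t \<le> enat (k - l)"
  by (cases t) auto

lemma finite_arrived: "finite (arrived \<tau> k \<omega>)"
  by (rule finite_subset[of _ "{..k}"]) (auto simp: arrived_def enat_add_le_iff)

lemma buffer_length_0: "buffer_length N \<tau> 0 \<omega> = 0"
  by (simp add: buffer_length_def)

text \<open>Turns the maximum in \<open>latest\<close> into an existential, the form used below. A
  level \<open>j \<ge> 1\<close> lies above both the default for an empty set and the truncation at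
  0, and T + N - k grows with T, so any arrived packet that is recent enough is a witness.\<close>

lemma le_buffer_length_iff:
  assumes "k \<ge> 1" "j \<ge> 1"
  shows "j \<le> buffer_length N \<tau> k \<omega> \<longleftrightarrow> (\<exists>l\<le>k. \<tau> l \<omega> \<le> enat (k - l) \<and> k + j \<le> l + N)"
proof (cases "arrived \<tau> k \<omega> = {}")
  case True
  then have "\<not> (l \<le> k \<and> \<tau> l \<omega> \<le> enat (k - l))" for l
    by (auto simp: arrived_def enat_add_le_iff)
  with True assms show ?thesis
    by (auto simp: buffer_length_def latest_def)
next
  case False
  define T where "T = Max (arrived \<tau> k \<omega>)"
  have T: "T \<in> arrived \<tau> k \<omega>" "\<And>l. l \<in> arrived \<tau> k \<omega> \<Longrightarrow> l \<le> T"
    using False finite_arrived[of \<tau> k \<omega>] by (auto simp: T_def)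
  have "buffer_length N \<tau> k \<omega> = nat (max 0 (int T + int N - int k))"
    using assms False by (simp add: buffer_length_def latest_def T_def)
  then have "j \<le> buffer_length N \<tau> k \<omega> \<longleftrightarrow> k + j \<le> T + N"
    using assms by linarith
  moreover have "l \<in> arrived \<tau> k \<omega> \<longleftrightarrow> l \<le> k \<and> \<tau> l \<omega> \<le> enat (k - l)" for l
    by (simp add: arrived_def enat_add_le_iff)
  ultimately show ?thesis
    using T by (meson add_le_mono1 order.trans)
qed

lemma buffer_length_le: "buffer_length N \<tau> k \<omega> \<le> N"
proof (cases "k = 0")
  case False
  then have "\<not> Suc N \<le> buffer_length N \<tau> k \<omega>"
    by (subst le_buffer_length_iff) auto
  then show ?thesis by simp
qed (simp add: buffer_length_0)

text \<open>The length sees a delay only through its comparison with the age of the packet. So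
  delays known to be late can be replaced by \<infinity>, and the sample point by a finite vector of
  delays.\<close>

lemma buffer_length_cong:
  assumes "\<And>l. l \<le> k \<Longrightarrow> \<tau> l \<omega> \<le> enat (k - l) \<longleftrightarrow> \<tau>' l \<omega>' \<le> enat (k - l)"
  shows "buffer_length N \<tau> k \<omega> = buffer_length N \<tau>' k \<omega>'"
proof -
  have "arrived \<tau> k \<omega> = arrived \<tau>' k \<omega>'"
    using assms by (auto simp: arrived_def enat_add_le_iff)
  then show ?thesis
    by (simp add: buffer_length_def latest_def)
qed

text \<open>The packet realizing the length at time \<open>k\<close> has also arrived by time
  \<open>k + 1\<close>, where it is worth one value less.\<close>

lemma buffer_length_Suc_ge:
  "buffer_length N \<tau> k \<omega> - 1 \<le> buffer_length N \<tau> (Suc k) \<omega>"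
proof (cases "k = 0 \<or> buffer_length N \<tau> k \<omega> \<le> 1")
  case False
  define i where "i = buffer_length N \<tau> k \<omega>"
  obtain l where l: "l \<le> k" "\<tau> l \<omega> \<le> enat (k - l)" "k + i \<le> l + N"
    using le_buffer_length_iff[of k i N \<tau> \<omega>] False by (auto simp: i_def)
  have "\<tau> l \<omega> \<le> enat (Suc k - l)"
    using l(2) by (rule order.trans) auto
  then have "i - 1 \<le> buffer_length N \<tau> (Suc k) \<omega>"
    using l False by (subst le_buffer_length_iff) (auto simp: i_def intro!: exI[of _ l])
  then show ?thesis
    by (simp add: i_def)
qed (auto simp: buffer_length_0)

text \<open>If \<open>N\<close> exceeded \<open>k\<close> plus the length, any arrived packet, even
  number 0, would force a greater length.\<close>

lemma le_add_buffer_length: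
  assumes "k \<ge> 1" "buffer_length N \<tau> k \<omega> \<ge> 1"
  shows "N \<le> k + buffer_length N \<tau> k \<omega>"
proof (rule ccontr)
  assume A: "\<not> ?thesis"
  obtain l where "l \<le> k" "\<tau> l \<omega> \<le> enat (k - l)"
    using le_buffer_length_iff[of k 1 N \<tau> \<omega>] assms by auto
  then have "Suc (buffer_length N \<tau> k \<omega>) \<le> buffer_length N \<tau> k \<omega>"
    using assms A by (subst le_buffer_length_iff) (auto intro!: exI[of _ l])
  then show False by simp
qed

lemma not_arrived_of_buffer_length:
  assumes "k \<ge> 1" "l \<le> k" "k + 1 + buffer_length N \<tau> k \<omega> - N \<le> l"
  shows "\<tau> l \<omega> > enat (k - l)"
proof (rule ccontr)
  assume "\<not> ?thesis"
  then have "buffer_length N \<tau> k \<omega> + 1 \<le> buffer_length N \<tau> k \<omega>"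
    using assms by (subst le_buffer_length_iff) (auto intro!: exI[of _ l])
  then show False by simp
qed

text \<open>Length \<open>j\<close> points to a single packet \<open>l\<close>, as
  \<open>N \<le> k + j\<close> rules out truncation; equality is split into reaching level
  \<open>j\<close> and missing level \<open>j + 1\<close>.\<close>

lemma buffer_length_eq_iff:
  assumes "k \<ge> 1" "1 \<le> j" "j \<le> N" "N \<le> k + j"
  defines "l \<equiv> k + j - N"
  shows "buffer_length N \<tau> k \<omega> = j \<longleftrightarrow>
    \<tau> l \<omega> \<le> enat (k - l) \<and> (\<forall>m\<in>{l<..k}. \<tau> m \<omega> > enat (k - m))"
proof -
  have l: "l \<le> k" "l + N = k + j"
    using assms by auto
  define R where "R = (\<lambda>m. m \<le> k \<and> \<tau> m \<omega> \<le> enat (k - m))"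
  have "j \<le> buffer_length N \<tau> k \<omega> \<longleftrightarrow> (\<exists>m. R m \<and> l \<le> m)"
    using l assms(1,2) by (subst le_buffer_length_iff) (auto simp: R_def)
  moreover have "j + 1 \<le> buffer_length N \<tau> k \<omega> \<longleftrightarrow> (\<exists>m. R m \<and> l < m)"
  proof -
    have "k + (j + 1) \<le> m + N \<longleftrightarrow> l < m" for m
      using l by linarith
    then show ?thesis
      using assms(1) by (subst le_buffer_length_iff) (auto simp: R_def)
  qed
  moreover have "i = j \<longleftrightarrow> j \<le> i \<and> \<not> j + 1 \<le> i" for i
    by auto
  ultimately have "buffer_length N \<tau> k \<omega> = j \<longleftrightarrow> (\<exists>m. R m \<and> l \<le> m) \<and> \<not> (\<exists>m. R m \<and> l < m)"
    by blast
  also have "\<dots> \<longleftrightarrow> R l \<and> (\<forall>m. l < m \<longrightarrow> \<not> R m)"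
    by (metis order_le_less)
  also have "\<dots> \<longleftrightarrow> \<tau> l \<omega> \<le> enat (k - l) \<and> (\<forall>m\<in>{l<..k}. \<tau> m \<omega> > enat (k - m))"
    using l(1) by (auto simp: R_def not_le)
  finally show ?thesis .
qed

section \<open>Independent delays: past and future packets\<close>

lemma (in prob_space) prob_indep_restrict:
  fixes X :: "'i \<Rightarrow> 'a \<Rightarrow> 'b :: countable"
  assumes X: "indep_vars (\<lambda>_. count_space UNIV) X UNIV"
    and fin: "finite A" "finite B" and disj: "A \<inter> B = {}"
  shows "\<P>(\<omega> in M. Q (restrict (\<lambda>i. X i \<omega>) A) \<and> R (restrict (\<lambda>i. X i \<omega>) B)) =
    \<P>(\<omega> in M. Q (restrict (\<lambda>i. X i \<omega>) A)) * \<P>(\<omega> in M. R (restrict (\<lambda>i. X i \<omega>) B))"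
proof -
  \<comment> \<open>Over finitely many countable factors the product sigma-algebra is the full power
    set, so \<open>Q\<close> and \<open>R\<close> may be arbitrary predicates.\<close>
  have *: "PiM C (\<lambda>_. count_space (UNIV :: 'b set)) = count_space (PiE C (\<lambda>_. UNIV))"
    if "finite C" for C :: "'i set"
    using that by (intro count_space_PiM_finite) auto
  have "indep_var (count_space (PiE A (\<lambda>_. UNIV))) (\<lambda>\<omega>. restrict (\<lambda>i. X i \<omega>) A)
      (count_space (PiE B (\<lambda>_. UNIV))) (\<lambda>\<omega>. restrict (\<lambda>i. X i \<omega>) B)"
    using indep_var_restrict[OF X disj] fin by (simp add: *)
  from indep_varD[OF this, of "{s \<in> PiE A (\<lambda>_. UNIV). Q s}" "{s \<in> PiE B (\<lambda>_. UNIV). R s}"]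
  show ?thesis
    by (auto simp: vimage_def Int_def conj_commute)
qed

locale iid_delays = prob_space M for M :: "'a measure" +
  fixes \<tau> :: "nat \<Rightarrow> 'a \<Rightarrow> enat" and a :: "nat \<Rightarrow> real"
  assumes indep: "indep_vars (\<lambda>_. count_space UNIV) \<tau> UNIV"
    and prob_delay: "\<And>k i. \<P>(\<omega> in M. \<tau> k \<omega> = enat i) = a i"
begin

lemma measurable_delay [measurable]: "\<tau> k \<in> measurable M (count_space UNIV)"
  using indep by (simp add: indep_vars_def2)

lemma measurable_restrict_delays:
  assumes "finite A"
  shows "(\<lambda>\<omega>. restrict (\<lambda>i. \<tau> i \<omega>) A) \<in> measurable M (count_space (PiE A (\<lambda>_. UNIV)))"
proof -
  have "(\<lambda>\<omega>. restrict (\<lambda>i. \<tau> i \<omega>) A) \<in> measurable M (PiM A (\<lambda>_. count_space UNIV))"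
    by measurable
  then show ?thesis
    using assms by (subst (asm) count_space_PiM_finite) auto
qed

lemma measurable_buffer_length [measurable]:
  "buffer_length N \<tau> k \<in> measurable M (count_space {0..N})"
proof -
  \<comment> \<open>Only finitely many delays matter, and on their discrete space every function is
    measurable.\<close>
  have *: "buffer_length N \<tau> k \<omega> = buffer_length N (\<lambda>l s. s l) k (restrict (\<lambda>i. \<tau> i \<omega>) {..k})" for \<omega>
    by (rule buffer_length_cong) auto
  show ?thesis
    unfolding *[abs_def]
    by (rule measurable_compose[OF measurable_restrict_delays])
       (auto simp: buffer_length_le)
qed

lemma pred_buffer_length [measurable]:
  "Measurable.pred M (\<lambda>\<omega>. buffer_length N \<tau> k \<omega> = i)"
proof -
  have "Measurable.pred M (\<lambda>\<omega>. buffer_length N \<tau> k \<omega> \<in> {i} \<inter> {0..N})"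
    by (rule pred_sets1[OF _ measurable_buffer_length]) auto
  then show ?thesis
    by (simp add: buffer_length_le)
qed

lemma prob_delay_gt: "\<P>(\<omega> in M. \<tau> k \<omega> > enat m) = 1 - (\<Sum>i\<le>m. a i)"
proof -
  have "\<P>(\<omega> in M. \<tau> k \<omega> > enat m) = 1 - \<P>(\<omega> in M. \<tau> k \<omega> \<le> enat m)"
    by (subst prob_neg[symmetric]) (auto simp: not_le)
  also have "{\<omega> \<in> space M. \<tau> k \<omega> \<le> enat m} = (\<Union>i\<in>{..m}. {\<omega> \<in> space M. \<tau> k \<omega> = enat i})"
    by (auto simp: Bex_def) (metis enat_ile enat_ord_simps(1))
  also have "prob \<dots> = (\<Sum>i\<le>m. a i)"
    by (subst finite_measure_finite_Union) (auto simp: disjoint_family_on_def prob_delay)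
  finally show ?thesis .
qed

text \<open>Separates an arbitrary event \<open>Q\<close> on packets before \<open>n\<close> from
  individual constraints on newer ones. The history and its one-step extension will be written with
  the same \<open>Q\<close>, so its probability need never be computed.\<close>

lemma prob_past_future:
  assumes "finite K" "K \<inter> {..<n} = {}"
  shows "\<P>(\<omega> in M. Q (restrict (\<lambda>i. \<tau> i \<omega>) {..<n}) \<and> (\<forall>l\<in>K. \<tau> l \<omega> \<in> B l)) =
    \<P>(\<omega> in M. Q (restrict (\<lambda>i. \<tau> i \<omega>) {..<n})) * (\<Prod>l\<in>K. \<P>(\<omega> in M. \<tau> l \<omega> \<in> B l))"
proof -
  have "\<P>(\<omega> in M. \<forall>l\<in>K. \<tau> l \<omega> \<in> B l) = (\<Prod>l\<in>K. \<P>(\<omega> in M. \<tau> l \<omega> \<in> B l))"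
  proof (cases "K = {}")
    case False
    have "\<P>(\<omega> in M. \<forall>l\<in>K. \<tau> l \<omega> \<in> B l) = prob (\<Inter>l\<in>K. \<tau> l -` B l \<inter> space M)"
      using False by (intro arg_cong[where f = prob]) auto
    also have "\<dots> = (\<Prod>l\<in>K. prob (\<tau> l -` B l \<inter> space M))"
      using False assms by (intro indep_varsD[OF indep]) auto
    finally show ?thesis
      by (simp add: vimage_def Int_def conj_commute)
  qed (simp add: prob_space)
  then show ?thesis
    using prob_indep_restrict[OF indep, of "{..<n}" K Q "\<lambda>s. \<forall>l\<in>K. s l \<in> B l"] assms
    by (simp add: Int_commute)
qed

text \<open>The history enters only through the packets generated in \<open>{n..k}\<close> being late at time \<open>k\<close>. At
  time \<open>k + 1\<close> the packet \<open>l\<close> arrives and the later ones are late by one more step, so their tail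
  probabilities are those of \<open>{l..k}\<close> shifted by one and cancel.\<close>

lemma prob_transition_up:
  assumes k: "k \<ge> 1" and I: "I \<subseteq> {..k}" "k \<in> I"
    and j: "1 \<le> j" "x k \<le> j" "j \<le> N" "N \<le> k + 1 + j"
  shows "\<P>(\<omega> in M. buffer_length N \<tau> (Suc k) \<omega> = j \<and> (\<forall>m\<in>I. buffer_length N \<tau> m \<omega> = x m)) =
    a (N - j) * \<P>(\<omega> in M. \<forall>m\<in>I. buffer_length N \<tau> m \<omega> = x m)"
proof -
  \<comment> \<open>Given length \<open>x k\<close>, no packet from \<open>n\<close> on has arrived
    by time \<open>k\<close>; \<open>n\<close> is 0 if the subtraction truncates. Only packet
    \<open>l\<close> can realize length \<open>j\<close> at time \<open>k + 1\<close>, and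
    \<open>x k \<le> j\<close> gives \<open>n \<le> l\<close>.\<close>
  define n where "n = k + 1 + x k - N"
  define l where "l = k + 1 + j - N"
  define S where "S = (\<lambda>m. 1 - (\<Sum>i\<le>m. a i))"
  \<comment> \<open>The history evaluated with all delays from \<open>n\<close> on set to
    \<infinity>, hence a function of the older delays.\<close>
  define Q where "Q = (\<lambda>s. \<forall>m\<in>I. buffer_length N (\<lambda>i s. if i < n then s i else \<infinity>) m s = x m)"
  define G where "G = (\<lambda>i. {enat (k - i)<..})"
  \<comment> \<open>Packets before \<open>l\<close> need only be late at time \<open>k\<close>,
    since \<open>l\<close> outranks them even if they arrive at \<open>k + 1\<close>; packet
    \<open>l\<close> arrives exactly at \<open>k + 1\<close>; newer ones are still late
    then.\<close>
  define G' where "G' = (\<lambda>i. if i < l then {enat (k - i)<..} else if i = l then {enat (N - j)}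
    else {enat (k + 1 - i)<..})"
  have nl: "n \<le> l" "l \<le> k + 1" "n \<le> k + 1" "k + 1 - l = N - j"
    using j by (auto simp: n_def l_def)
  \<comment> \<open>Lateness at time \<open>k\<close> implies lateness at every time in
    \<open>I\<close>, so on that event \<open>Q\<close> agrees with the history; conversely, as
    \<open>k \<in> I\<close>, the history forces the lateness.\<close>
  have hist: "(\<forall>m\<in>I. buffer_length N \<tau> m \<omega> = x m) \<longleftrightarrow>
      Q (restrict (\<lambda>i. \<tau> i \<omega>) {..<n}) \<and> (\<forall>i\<in>{n..k}. \<tau> i \<omega> \<in> G i)" for \<omega>
  proof -
    have "(\<forall>m\<in>I. buffer_length N \<tau> m \<omega> = x m) \<longleftrightarrow> Q (restrict (\<lambda>i. \<tau> i \<omega>) {..<n})"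
      if late: "\<forall>i\<in>{n..k}. \<tau> i \<omega> \<in> G i"
      unfolding Q_def
    proof (intro ball_cong refl arg_cong2[where f = "(=)"] buffer_length_cong)
      fix m i assume m: "m \<in> I" and i: "i \<le> m"
      have "\<tau> i \<omega> > enat (m - i)" if "\<not> i < n"
      proof -
        have "enat (m - i) \<le> enat (k - i)"
          using m I by auto
        also have "\<dots> < \<tau> i \<omega>"
          using late that m i I by (auto simp: G_def)
        finally show ?thesis .
      qed
      then show "\<tau> i \<omega> \<le> enat (m - i) \<longleftrightarrow>
          (if i < n then restrict (\<lambda>i. \<tau> i \<omega>) {..<n} i else \<infinity>) \<le> enat (m - i)"
        by (auto simp: not_le[symmetric])
    qed
    moreover have "\<forall>i\<in>{n..k}. \<tau> i \<omega> \<in> G i" if "\<forall>m\<in>I. buffer_length N \<tau> m \<omega> = x m"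
    proof
      fix i assume i: "i \<in> {n..k}"
      have "buffer_length N \<tau> k \<omega> = x k"
        using that I by blast
      then show "\<tau> i \<omega> \<in> G i"
        using not_arrived_of_buffer_length[OF k, of i N \<tau> \<omega>] i by (simp add: G_def n_def)
    qed
    ultimately show ?thesis by blast
  qed
  have step: "buffer_length N \<tau> (Suc k) \<omega> = j \<and> (\<forall>i\<in>{n..k}. \<tau> i \<omega> \<in> G i) \<longleftrightarrow>
      (\<forall>i\<in>{n..k+1}. \<tau> i \<omega> \<in> G' i)" for \<omega>
  proof -
    have new: "buffer_length N \<tau> (Suc k) \<omega> = j \<longleftrightarrow>
        \<tau> l \<omega> \<le> enat (k + 1 - l) \<and> (\<forall>i\<in>{l<..k + 1}. \<tau> i \<omega> > enat (k + 1 - i))"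
      using buffer_length_eq_iff[of "k + 1" j N \<tau> \<omega>] j by (simp add: l_def)
    \<comment> \<open>Late at time \<open>k\<close> but arrived by \<open>k + 1\<close> leaves a
      single delay. For \<open>l = k + 1\<close> the upper bound 0 alone does so.\<close>
    have exact: "\<tau> l \<omega> = enat (k + 1 - l)"
      if "\<tau> l \<omega> \<le> enat (k + 1 - l)" "l \<le> k \<longrightarrow> \<tau> l \<omega> > enat (k - l)"
      using that nl(2) by (cases "\<tau> l \<omega>") (auto split: if_splits)
    have weaken: "t > enat (k - i)" if "t > enat (k + 1 - i)" for t i
      using that by (rule le_less_trans[rotated]) auto
    show ?thesis
    proof
      assume A: "buffer_length N \<tau> (Suc k) \<omega> = j \<and> (\<forall>i\<in>{n..k}. \<tau> i \<omega> \<in> G i)"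
      then have "\<tau> l \<omega> = enat (k + 1 - l)"
        using nl by (intro exact) (auto simp: new G_def)
      with A show "\<forall>i\<in>{n..k+1}. \<tau> i \<omega> \<in> G' i"
        using nl by (auto simp: new G_def G'_def)
    next
      assume B: "\<forall>i\<in>{n..k+1}. \<tau> i \<omega> \<in> G' i"
      have "\<tau> l \<omega> = enat (k + 1 - l)"
        using B[rule_format, of l] nl by (simp add: G'_def)
      moreover have late: "\<tau> i \<omega> > enat (k + 1 - i)" if "i \<in> {l<..k + 1}" for i
        using B[rule_format, of i] nl that by (simp add: G'_def)
      moreover have "\<tau> i \<omega> \<in> G i" if "i \<in> {n..k}" for i
      proof (cases i l rule: linorder_cases)
        case less
        then show ?thesis
          using B[rule_format, of i] that by (simp add: G'_def G_def)
      next
        case equal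
        then show ?thesis
          using \<open>\<tau> l \<omega> = _\<close> that by (auto simp: G_def)
      next
        case greater
        then show ?thesis
          using late[of i] weaken that by (auto simp: G_def)
      qed
      ultimately show "buffer_length N \<tau> (Suc k) \<omega> = j \<and> (\<forall>i\<in>{n..k}. \<tau> i \<omega> \<in> G i)"
        by (auto simp: new)
    qed
  qed
  have "(\<Prod>i\<in>{n..k+1}. \<P>(\<omega> in M. \<tau> i \<omega> \<in> G' i)) =
      (\<Prod>i\<in>{n..<l}. S (k - i)) * a (N - j) * (\<Prod>i\<in>{Suc l..Suc k}. S (k + 1 - i))"
  proof -
    have "{n..k+1} = {n..<l} \<union> ({l} \<union> {Suc l..Suc k})"
      using nl by auto
    then have "(\<Prod>i\<in>{n..k+1}. \<P>(\<omega> in M. \<tau> i \<omega> \<in> G' i)) =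
        (\<Prod>i\<in>{n..<l}. \<P>(\<omega> in M. \<tau> i \<omega> \<in> G' i)) * (\<P>(\<omega> in M. \<tau> l \<omega> \<in> G' l) *
         (\<Prod>i\<in>{Suc l..Suc k}. \<P>(\<omega> in M. \<tau> i \<omega> \<in> G' i)))"
      by (simp only:) (subst prod.union_disjoint; auto)
    then show ?thesis
      by (simp add: G'_def S_def prob_delay_gt prob_delay mult.assoc)
  qed
  also have "(\<Prod>i\<in>{Suc l..Suc k}. S (k + 1 - i)) = (\<Prod>i\<in>{l..k}. S (k - i))"
    by (subst prod.shift_bounds_cl_Suc_ivl) simp
  also have "(\<Prod>i\<in>{n..<l}. S (k - i)) * a (N - j) * (\<Prod>i\<in>{l..k}. S (k - i)) =
      a (N - j) * (\<Prod>i\<in>{n..k}. S (k - i))"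
  proof -
    have "{n..k} = {n..<l} \<union> {l..k}"
      using nl by auto
    then show ?thesis
      by (simp only:) (subst prod.union_disjoint; auto)
  qed
  also have "(\<Prod>i\<in>{n..k}. S (k - i)) = (\<Prod>i\<in>{n..k}. \<P>(\<omega> in M. \<tau> i \<omega> \<in> G i))"
    by (simp add: G_def S_def prob_delay_gt)
  finally have prods: "(\<Prod>i\<in>{n..k+1}. \<P>(\<omega> in M. \<tau> i \<omega> \<in> G' i)) =
      a (N - j) * (\<Prod>i\<in>{n..k}. \<P>(\<omega> in M. \<tau> i \<omega> \<in> G i))" .
  have "buffer_length N \<tau> (Suc k) \<omega> = j \<and> (\<forall>m\<in>I. buffer_length N \<tau> m \<omega> = x m) \<longleftrightarrow>
      Q (restrict (\<lambda>i. \<tau> i \<omega>) {..<n}) \<and> (\<forall>i\<in>{n..k+1}. \<tau> i \<omega> \<in> G' i)" for \<omega>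
    using hist[of \<omega>] step[of \<omega>] by blast
  then show ?thesis
    using prob_past_future[of "{n..k+1}" n Q G'] prob_past_future[of "{n..k}" n Q G]
    by (simp only: hist prods) (simp add: disjoint_iff)
qed

text \<open>The condition \<open>N \<le> k + 1 + j\<close> says that the packet realizing length \<open>j\<close> at time \<open>k + 1\<close>
  has a nonnegative index.\<close>

definition arrival_prob :: "nat \<Rightarrow> nat \<Rightarrow> nat \<Rightarrow> real" where
  "arrival_prob N k j = (if j \<le> N \<and> N \<le> k + 1 + j then a (N - j) else 0)"

text \<open>The entry at \<open>i - 1\<close> is the complement of the upward ones. For
  \<open>i = 0\<close>, truncated subtraction together with \<open>max 1 i\<close> yields the row of
  \<open>i = 1\<close>: an empty buffer and one about to run empty behave alike.\<close>

definition transition_prob :: "nat \<Rightarrow> nat \<Rightarrow> nat \<Rightarrow> nat \<Rightarrow> real" where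
  "transition_prob N k i j =
    (if 1 \<le> j \<and> i \<le> j then arrival_prob N k j
     else if j = i - 1 then 1 - (\<Sum>j'=max 1 i..N. arrival_prob N k j')
     else 0)"

section \<open>One-step probabilities given a history\<close>

lemma prob_arrival:
  assumes "k \<ge> 1" "I \<subseteq> {..k}" "k \<in> I" "1 \<le> j" "x k \<le> j"
  shows "\<P>(\<omega> in M. buffer_length N \<tau> (Suc k) \<omega> = j \<and> (\<forall>m\<in>I. buffer_length N \<tau> m \<omega> = x m)) =
    arrival_prob N k j * \<P>(\<omega> in M. \<forall>m\<in>I. buffer_length N \<tau> m \<omega> = x m)"
proof (cases "j \<le> N \<and> N \<le> k + 1 + j")
  case True
  then show ?thesis
    using prob_transition_up[of k I j x N] assms by (simp add: arrival_prob_def)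
next
  case False
  \<comment> \<open>A length above \<open>N\<close>, or one whose packet would have a negative
    index, never occurs, so both sides vanish.\<close>
  have "buffer_length N \<tau> (Suc k) \<omega> \<noteq> j" for \<omega>
    using False buffer_length_le[of N \<tau> "Suc k" \<omega>] le_add_buffer_length[of "Suc k" N \<tau> \<omega>] assms
    by auto
  then show ?thesis
    using False by (auto simp: arrival_prob_def)
qed

text \<open>Upward moves are \<open>prob_arrival\<close>; the only other reachable length is
  \<open>x k - 1\<close>, which takes the remaining mass. As \<open>I\<close> may be
  \<open>{..k}\<close> or \<open>{k}\<close> and the state enters the factor through
  \<open>x k\<close> alone, this contains the Markov property for \<open>k \<ge> 1\<close>.\<close>

lemma prob_transition:
  assumes k: "k \<ge> 1" and I: "I \<subseteq> {..k}" "k \<in> I"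
  shows "\<P>(\<omega> in M. buffer_length N \<tau> (Suc k) \<omega> = j \<and> (\<forall>m\<in>I. buffer_length N \<tau> m \<omega> = x m)) =
    transition_prob N k (x k) j * \<P>(\<omega> in M. \<forall>m\<in>I. buffer_length N \<tau> m \<omega> = x m)"
proof -
  define H where "H = (\<lambda>\<omega>. \<forall>m\<in>I. buffer_length N \<tau> m \<omega> = x m)"
  define E where "E = (\<lambda>j. {\<omega> \<in> space M. buffer_length N \<tau> (Suc k) \<omega> = j \<and> H \<omega>})"
  define U where "U = {max 1 (x k)..N}"
  have "finite I"
    using I finite_subset by blast
  then have [measurable]: "Measurable.pred M H"
    unfolding H_def by measurable
  have E_sets [measurable]: "E j \<in> sets M" for j
    unfolding E_def by measurable
  have up: "prob (E j) = arrival_prob N k j * \<P>(\<omega> in M. H \<omega>)" if "1 \<le> j" "x k \<le> j" for j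
    using prob_arrival[of k I j x N] k I that by (simp add: E_def H_def)
  have ge: "x k - 1 \<le> buffer_length N \<tau> (Suc k) \<omega>" if "H \<omega>" for \<omega>
    using buffer_length_Suc_ge[of N \<tau> k \<omega>] that I by (auto simp: H_def)
  have "{\<omega> \<in> space M. H \<omega>} = (\<Union>j\<in>insert (x k - 1) U. E j)"
  proof -
    have "buffer_length N \<tau> (Suc k) \<omega> \<in> insert (x k - 1) U" if "H \<omega>" for \<omega>
      using ge[OF that] buffer_length_le[of N \<tau> "Suc k" \<omega>] by (auto simp: U_def)
    then show ?thesis
      by (auto simp: E_def)
  qed
  then have "\<P>(\<omega> in M. H \<omega>) = prob (\<Union>j\<in>insert (x k - 1) U. E j)"
    by simp
  also have "\<dots> = (\<Sum>j\<in>insert (x k - 1) U. prob (E j))"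
    by (rule finite_measure_finite_Union) (auto simp: disjoint_family_on_def E_def U_def)
  also have "\<dots> = prob (E (x k - 1)) + (\<Sum>j\<in>U. prob (E j))"
    by (subst sum.insert) (auto simp: U_def)
  also have "(\<Sum>j\<in>U. prob (E j)) = (\<Sum>j\<in>U. arrival_prob N k j) * \<P>(\<omega> in M. H \<omega>)"
    unfolding sum_distrib_right by (intro sum.cong refl up) (auto simp: U_def)
  finally have down: "prob (E (x k - 1)) = (1 - (\<Sum>j\<in>U. arrival_prob N k j)) * \<P>(\<omega> in M. H \<omega>)"
    by (simp add: algebra_simps)
  \<comment> \<open>What remains is \<open>j < x k - 1\<close>, excluded because the buffer loses at
    most one value per step.\<close>
  have "prob (E j) = 0" if "j \<noteq> x k - 1" "\<not> (1 \<le> j \<and> x k \<le> j)"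
  proof -
    have "E j = {}"
      using ge that by (fastforce simp: E_def)
    then show ?thesis by simp
  qed
  then have "prob (E j) = transition_prob N k (x k) j * \<P>(\<omega> in M. H \<omega>)"
    using up[of j] down by (auto simp: transition_prob_def U_def)
  then show ?thesis
    by (simp add: E_def H_def)
qed

lemma cond_prob_transition:
  assumes "k \<ge> 1" "I \<subseteq> {..k}" "k \<in> I" "\<P>(\<omega> in M. \<forall>m\<in>I. buffer_length N \<tau> m \<omega> = x m) > 0"
  shows "\<P>(\<omega> in M. buffer_length N \<tau> (Suc k) \<omega> = j \<bar> \<forall>m\<in>I. buffer_length N \<tau> m \<omega> = x m) =
    transition_prob N k (x k) j"
  using prob_transition[OF assms(1-3), of N j x] assms(4) by (simp add: cond_prob_def)

lemma markov_chain_buffer_length: "markov_chain M {0..N} (buffer_length N \<tau>)"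
  unfolding markov_chain_def
proof (intro conjI allI impI)
  fix k and x :: "nat \<Rightarrow> nat" and j
  assume pos: "\<P>(\<omega> in M. \<forall>m\<le>k. buffer_length N \<tau> m \<omega> = x m) > 0"
  show "\<P>(\<omega> in M. buffer_length N \<tau> (Suc k) \<omega> = j \<bar> \<forall>m\<le>k. buffer_length N \<tau> m \<omega> = x m) =
    \<P>(\<omega> in M. buffer_length N \<tau> (Suc k) \<omega> = j \<bar> buffer_length N \<tau> k \<omega> = x k)"
  \<comment> \<open>At time 0 the history is just the present state.\<close>
  proof (cases "k = 0")
    case False
    have "\<P>(\<omega> in M. \<forall>m\<le>k. buffer_length N \<tau> m \<omega> = x m) \<le> \<P>(\<omega> in M. buffer_length N \<tau> k \<omega> = x k)"
      by (intro finite_measure_mono) auto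
    with pos False show ?thesis
      using cond_prob_transition[of k "{..k}" N x j] cond_prob_transition[of k "{k}" N x j]
      by (simp add: Ball_def)
  qed simp
qed measurable

text \<open>Under the two conditions on the state, the index condition in
  \<open>arrival_prob\<close> holds for every relevant length, and the dependence on
  \<open>k\<close> disappears. Time 0 survives only for \<open>i = 0\<close> and
  \<open>N = 1\<close>, where the buffer at time 1 is full exactly if packet 1 arrives at
  once.\<close>

lemma transition_prob_past_startup:
  assumes pos: "\<P>(\<omega> in M. buffer_length N \<tau> k \<omega> = i) > 0" and ps: "past_startup N k i"
    and ij: "i \<le> N" "j \<le> N" and "N \<ge> 1"
  shows "\<P>(\<omega> in M. buffer_length N \<tau> (Suc k) \<omega> = j \<bar> buffer_length N \<tau> k \<omega> = i) =
    (if 1 \<le> j \<and> i \<le> j then a (N - j)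
     else if j = i - 1 then 1 - (\<Sum>l=0..N - max 1 i. a l) else 0)"
proof (cases "k = 0")
  case True
  have "i = 0"
    using pos True by (cases "i = 0") (auto simp: buffer_length_0)
  then have N: "N = 1"
    using ps True by (simp add: past_startup_def)
  have one: "buffer_length N \<tau> (Suc 0) \<omega> = 1 \<longleftrightarrow> \<tau> 1 \<omega> = 0" for \<omega>
    using buffer_length_eq_iff[of 1 1 1 \<tau> \<omega>] by (simp add: N zero_enat_def[symmetric])
  have zero: "buffer_length N \<tau> (Suc 0) \<omega> = 0 \<longleftrightarrow> \<not> \<tau> 1 \<omega> = 0" for \<omega>
    using one[of \<omega>] buffer_length_le[of N \<tau> "Suc 0" \<omega>] N by auto
  have "\<P>(\<omega> in M. \<tau> 1 \<omega> = 0) = a 0"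
    using prob_delay[of 1 0] by (simp add: zero_enat_def)
  moreover have "\<P>(\<omega> in M. \<not> \<tau> 1 \<omega> = 0) = 1 - \<P>(\<omega> in M. \<tau> 1 \<omega> = 0)"
    by (rule prob_neg) measurable
  moreover have "j = 0 \<or> j = 1"
    using ij N by auto
  ultimately show ?thesis
    using one zero True \<open>i = 0\<close> N by (auto simp: cond_prob_def buffer_length_0 prob_space)
next
  case False
  \<comment> \<open>The smallest positive target suffices. For an empty buffer the bound comes from
    \<open>past_startup\<close>; for \<open>i > 0\<close> the event contains some \<omega>, to which
    \<open>le_add_buffer_length\<close> applies.\<close>
  have "N \<le> k + 1 + max 1 i"
  proof (cases "i = 0")
    case True
    with ps False show ?thesis
      by (auto simp: past_startup_def)
  next
    case i: False
    obtain \<omega> where "buffer_length N \<tau> k \<omega> = i"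
      using pos by (metis (mono_tags, lifting) Collect_empty_eq less_irrefl measure_empty)
    then show ?thesis
      using le_add_buffer_length[of k N \<tau> \<omega>] False i by simp
  qed
  then have arr: "arrival_prob N k j' = a (N - j')" if "max 1 i \<le> j'" "j' \<le> N" for j'
    using that by (auto simp: arrival_prob_def)
  have "(\<Sum>j'=max 1 i..N. arrival_prob N k j') = (\<Sum>j'=max 1 i..N. a (N - j'))"
    by (intro sum.cong) (auto intro!: arr)
  also have "\<dots> = (\<Sum>l=0..N - max 1 i. a l)"
    using ij \<open>N \<ge> 1\<close>
    by (intro sum.reindex_bij_witness[of _ "\<lambda>l. N - l" "\<lambda>l. N - l"]) auto
  finally show ?thesis
    using cond_prob_transition[of k "{k}" N "\<lambda>_. i" j] False pos arr[of j] ij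
    by (auto simp: transition_prob_def)
qed

end

section \<open>From conditionally to unconditionally i.i.d. delays\<close>

lemma (in prob_space) iid_delays_of_cond_iid:
  fixes \<gamma> :: "nat \<Rightarrow> 'a \<Rightarrow> nat"
  assumes \<gamma>: "indep_vars (\<lambda>_. count_space UNIV) \<gamma> UNIV"
    and q: "\<And>k. \<P>(\<omega> in M. \<gamma> k \<omega> = 1) = q"
    and range: "\<And>k \<omega>. \<omega> \<in> space M \<Longrightarrow> \<gamma> k \<omega> \<in> {0, 1}"
    and meas [measurable]: "\<And>k. \<tau> k \<in> measurable M (count_space UNIV)"
    and lost: "\<And>k \<omega>. \<omega> \<in> space M \<Longrightarrow> \<gamma> k \<omega> = 0 \<Longrightarrow> \<tau> k \<omega> = \<infinity>"
    and cond: "cond_iid_delays M \<gamma> \<tau> p p_inf"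
  shows "iid_delays M \<tau> (\<lambda>i. q * p i)"
proof -
  have [measurable]: "\<gamma> k \<in> measurable M (count_space UNIV)" for k
    using \<gamma> by (simp add: indep_vars_def2)
  \<comment> \<open>Finite delays imply that all packets in \<open>J\<close> were generated, so the
    joint probability is the conditional one times \<open>q ^ card J\<close>.\<close>
  have joint: "\<P>(\<omega> in M. \<forall>k\<in>J. \<tau> k \<omega> = enat (f k)) = (\<Prod>k\<in>J. q * p (f k))"
    if J: "finite J" "J \<noteq> {}" for J f
  proof -
    have "\<P>(\<omega> in M. \<forall>k\<in>J. \<gamma> k \<omega> = 1) = prob (\<Inter>k\<in>J. \<gamma> k -` {1} \<inter> space M)"
      using J by (intro arg_cong[where f = prob]) auto
    also have "\<dots> = (\<Prod>k\<in>J. prob (\<gamma> k -` {1} \<inter> space M))"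
      using J by (intro indep_varsD[OF \<gamma>]) auto
    also have "\<dots> = q ^ card J"
      using q by (simp add: vimage_def Int_def conj_commute)
    finally have gen: "\<P>(\<omega> in M. \<forall>k\<in>J. \<gamma> k \<omega> = 1) = q ^ card J" .
    have "\<P>(\<omega> in M. \<forall>k\<in>J. \<tau> k \<omega> = enat (f k)) =
        \<P>(\<omega> in M. (\<forall>k\<in>J. \<tau> k \<omega> = enat (f k)) \<and> (\<forall>k\<in>J. \<gamma> k \<omega> = 1))"
    proof (intro arg_cong[where f = prob] Collect_cong conj_cong refl iffI conjI ballI)
      fix \<omega> k assume "\<omega> \<in> space M" "\<forall>k\<in>J. \<tau> k \<omega> = enat (f k)" "k \<in> J"
      then show "\<gamma> k \<omega> = 1"
        using range[of \<omega> k] lost[of \<omega> k] by auto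
    qed auto
    also have "\<dots> = q ^ card J * (\<Prod>k\<in>J. p (f k))"
    proof (cases "q ^ card J = 0")
      \<comment> \<open>Here the conditional law says nothing, but the event lies in a null
        event.\<close>
      case True
      have "\<P>(\<omega> in M. (\<forall>k\<in>J. \<tau> k \<omega> = enat (f k)) \<and> (\<forall>k\<in>J. \<gamma> k \<omega> = 1)) \<le>
          \<P>(\<omega> in M. \<forall>k\<in>J. \<gamma> k \<omega> = 1)"
        using J by (intro finite_measure_mono) auto
      also have "\<dots> = 0"
        using gen True by simp
      finally have "\<P>(\<omega> in M. (\<forall>k\<in>J. \<tau> k \<omega> = enat (f k)) \<and> (\<forall>k\<in>J. \<gamma> k \<omega> = 1)) = 0"
        by (rule order_antisym) (rule measure_nonneg)
      then show ?thesis
        by (simp only: True mult_zero_left)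
    next
      case False
      then have pos: "\<P>(\<omega> in M. \<forall>k\<in>J. \<gamma> k \<omega> = 1) > 0"
        by (simp only: gen[symmetric] zero_less_measure_iff not_False_eq_True)
      have "\<P>(\<omega> in M. (\<forall>k\<in>J. \<tau> k \<omega> = enat (f k)) \<bar> \<forall>k\<in>J. \<gamma> k \<omega> = 1) =
          (\<Prod>k\<in>J. delay_law p p_inf (enat (f k)))"
        by (rule cond[unfolded cond_iid_delays_def, THEN spec, THEN mp, OF J(1), THEN mp, OF pos,
              THEN spec])
      then show ?thesis
        using False by (simp only: cond_prob_def gen delay_law_def enat.case)
          (simp add: nonzero_divide_eq_eq mult.commute)
    qed
    finally show ?thesis
      by (simp add: prod.distrib)
  qed
  define E where "E = (\<lambda>k i. {\<omega> \<in> space M. \<tau> k \<omega> = enat i})"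
  \<comment> \<open>Adding the empty set makes \<open>F k\<close> stable under intersections, as
    different delay values give disjoint events.\<close>
  define F where "F = (\<lambda>k. insert {} (range (E k)))"
  have E_sets: "E k i \<in> sets M" for k i
    unfolding E_def by measurable
  have prob_E: "prob (E k i) = q * p i" for k i
    using joint[of "{k}" "\<lambda>_. i"] by (simp add: E_def)
  have "indep_sets F UNIV"
  proof (rule indep_setsI)
    fix A and J :: "nat set"
    assume J: "J \<noteq> {}" "finite J" and A: "\<forall>j\<in>J. A j \<in> F j"
    show "prob (\<Inter>j\<in>J. A j) = (\<Prod>j\<in>J. prob (A j))"
    proof (cases "\<exists>j\<in>J. A j = {}")
      case True
      then have "(\<Inter>j\<in>J. A j) = {}"
        by blast
      moreover have "(\<Prod>j\<in>J. prob (A j)) = 0"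
        using True J by (intro prod_zero) (simp, metis measure_empty)
      ultimately show ?thesis by simp
    next
      case False
      then have "\<forall>j\<in>J. \<exists>i. A j = E j i"
        using A unfolding F_def by blast
      then obtain f where f: "\<And>j. j \<in> J \<Longrightarrow> A j = E j (f j)"
        by metis
      have "(\<Inter>j\<in>J. A j) = {\<omega> \<in> space M. \<forall>j\<in>J. \<tau> j \<omega> = enat (f j)}"
        using J f by (auto simp: E_def)
      then show ?thesis
        using joint[OF J(2,1)] f prob_E by simp
    qed
  qed (auto simp: F_def E_sets)
  moreover have "Int_stable (F k)" for k
    by (auto simp: Int_stable_def F_def E_def)
  ultimately have indep: "indep_sets (\<lambda>k. sigma_sets (space M) (F k)) UNIV"
    by (rule indep_sets_sigma)
  \<comment> \<open>The preimage is a countable union of events \<open>E k i\<close> or, if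
    \<open>A\<close> contains \<infinity>, the complement of one; so the finite delays generate
    everything.\<close>
  have "\<tau> k -` A \<inter> space M \<in> sigma_sets (space M) (F k)" for k A
  proof -
    interpret S: sigma_algebra "space M" "sigma_sets (space M) (F k)"
      by (rule sigma_algebra_sigma_sets) (auto simp: F_def E_def)
    have E: "E k i \<in> sigma_sets (space M) (F k)" for i
      by (rule sigma_sets.Basic) (simp add: F_def)
    have fin: "(\<Union>i\<in>B. E k i) \<in> sigma_sets (space M) (F k)" for B
      using E by (intro S.countable_UN') auto
    show ?thesis
    proof (cases "\<infinity> \<in> A")
      case True
      have "\<tau> k -` A \<inter> space M = space M - (\<Union>i\<in>{i. enat i \<notin> A}. E k i)"
        using True by (auto simp: E_def) (metis not_infinity_eq)
      then show ?thesis
        using fin by (metis S.compl_sets)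
    next
      case False
      have "\<tau> k -` A \<inter> space M = (\<Union>i\<in>{i. enat i \<in> A}. E k i)"
        using False by (auto simp: E_def) (metis not_infinity_eq)
      then show ?thesis
        using fin by simp
    qed
  qed
  then have "indep_vars (\<lambda>_. count_space UNIV) \<tau> UNIV"
    unfolding indep_vars_def2 by (intro conjI ballI indep_sets_mono_sets[OF indep]) auto
  with prob_E show ?thesis
    by unfold_locales (auto simp: E_def)
qed

theorem lemma1:
  fixes M :: "'a measure" and \<gamma> :: "nat \<Rightarrow> 'a \<Rightarrow> nat" and \<tau> :: "nat \<Rightarrow> 'a \<Rightarrow> enat"
    and N :: nat and q p_inf :: real and p :: "nat \<Rightarrow> real"
  assumes "prob_space M"
    and "N \<ge> 1"
    and "\<And>k \<omega>. \<omega> \<in> space M \<Longrightarrow> \<gamma> k \<omega> \<in> {0, 1}"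
    and "prob_space.indep_vars M (\<lambda>_. count_space UNIV) \<gamma> UNIV"
    and "\<And>k. \<P>(\<omega> in M. \<gamma> k \<omega> = 1) = q"
    and "\<And>k. \<tau> k \<in> measurable M (count_space UNIV)"
    and "\<And>k \<omega>. \<omega> \<in> space M \<Longrightarrow> \<gamma> k \<omega> = 0 \<Longrightarrow> \<tau> k \<omega> = \<infinity>"
    and "cond_iid_delays M \<gamma> \<tau> p p_inf"
  shows "markov_chain M {0..N} (buffer_length N \<tau>) \<and>
    (\<exists>P :: nat \<Rightarrow> nat \<Rightarrow> real.
      (\<forall>k. \<forall>i\<in>{0..N}. \<forall>j\<in>{0..N}.
         past_startup N k i \<longrightarrow> \<P>(\<omega> in M. buffer_length N \<tau> k \<omega> = i) > 0 \<longrightarrow>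
         \<P>(\<omega> in M. buffer_length N \<tau> (k + 1) \<omega> = j \<bar> buffer_length N \<tau> k \<omega> = i) = P i j) \<and>
      (\<forall>i\<in>{0..N}. \<forall>j\<in>{0..N}.
         (1 \<le> i \<and> i \<le> j \<longrightarrow> P i j = q * p (N - j)) \<and>
         (i = j + 1 \<longrightarrow> P i j = 1 - q * (\<Sum>l = 0..N - i. p l)) \<and>
         (i \<ge> j + 2 \<longrightarrow> P i j = 0) \<and>
         (i = 0 \<longrightarrow> P i j = P 1 j)))"
proof -
  interpret prob_space M by fact
  interpret iid_delays M \<tau> "\<lambda>i. q * p i"
    using assms by (intro iid_delays_of_cond_iid) auto
  \<comment> \<open>Given by the closed formula, \<open>P\<close> also has values at states of
    probability zero. Rows 0 and 1 coincide because of \<open>max 1 i\<close> and truncated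
    subtraction.\<close>
  define P where "P = (\<lambda>i j. if 1 \<le> j \<and> i \<le> j then q * p (N - j)
    else if j = i - 1 then 1 - (\<Sum>l=0..N - max 1 i. q * p l) else 0)"
  have "\<P>(\<omega> in M. buffer_length N \<tau> (k + 1) \<omega> = j \<bar> buffer_length N \<tau> k \<omega> = i) = P i j"
    if "i \<le> N" "j \<le> N" "past_startup N k i" "\<P>(\<omega> in M. buffer_length N \<tau> k \<omega> = i) > 0" for k i j
    using transition_prob_past_startup[of N k i j] that assms(2) by (simp add: P_def)
  moreover have "1 \<le> i \<and> i \<le> j \<longrightarrow> P i j = q * p (N - j)"
      "i = j + 1 \<longrightarrow> P i j = 1 - q * (\<Sum>l = 0..N - i. p l)"
      "i \<ge> j + 2 \<longrightarrow> P i j = 0" "i = 0 \<longrightarrow> P i j = P 1 j" for i j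
    by (auto simp: P_def sum_distrib_left)
  ultimately show ?thesis
    using markov_chain_buffer_length by (intro conjI exI[of _ P]) auto
qed

end
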